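(* Consider $\mathsf{maxQPE}_{N,\delta}$ with advice given as $t$ copies of an advice state of overlap at least $\gamma$, where $N\ge2$, $\gamma\in[1/\sqrt N,1]$, $\delta\in(0,1)$ and $t=\Omega(1/\gamma^2)$. Then every algorithm solving this task in the known-eigenbasis case (and hence also every algorithm solving it in the unknown-eigenbasis case) has cost $\Omega\left(\frac{1}{\gamma\delta}\right)$. Precisely: for every $a>0$ there is $c>0$ such that for all integers $N\ge2$, all $\gamma\in[1/\sqrt N,1]$, all $\delta\in(0,1)$ and all integers $t\ge a/\gamma^2$, every such algorithm has cost at least $\frac{c}{\gamma\delta}$.
   Context: Model of computation. The input is an unknown $N$-dimensional unitary $U$. The state space is $\mathbb{C}^N\otimes W$, where the first register is $N$-dimensional with computational basis $|0\rangle,\dots,|N-1\rangle$ and $W$ is an arbitrarily large (finite-dimensional) workspace. The algorithm may apply $U$ and $U^{-1}$ to the first register (possibly controlled by a qubit of the workspace), and arbitrary unitaries independent of $U$ to the whole space; at the end it performs a POVM (independent of $U$) which determines the classical output. The starting state is the all-zero state together with the given copies of the advice state. The cost of the algorithm is the total number of applications of $U$ and $U^{-1}$ (including controlled versions); all other operations are free. The task $\mathsf{maxQPE}_{N,\delta}$ with $t$ advice states of overlap at least $\gamma$. Let $U=\sum_{j=0}^{N-1}e^{i\theta_j}|u_j\rangle\langle u_j|$ with orthonormal eigenbasis $(|u_j\rangle)$ and $\theta_j\in[0,2\pi)$, let $\theta_{\max}=\max_j\theta_j$, and let $S$ be the span of all eigenstates with eigenphase $\theta_{\max}$. Input promise: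 $\theta_{\max}\in[0,2\pi-2\delta)$. In the known-eigenbasis case $U$ is moreover promised to be diagonal in the computational basis ($|u_j\rangle=|j\rangle$); in the unknown-eigenbasis case the eigenbasis is arbitrary and unknown. Advice: the algorithm is given $t$ copies of a state $|\alpha\rangle\in\mathbb{C}^N$ with $\|P_S|\alpha\rangle\|^2\ge\gamma^2$, where $P_S$ is the orthogonal projection onto $S$. Output: with probability at least $2/3$, a value in $[\theta_{\max}-\delta,\theta_{\max}+\delta]$ modulo $2\pi$. The algorithm (which may depend on $N,\delta,\gamma,t$) must be correct for every $U$ satisfying the promise and every valid $|\alpha\rangle$. *)

theory Defs
  imports "Jordan_Normal_Form.Schur_Decomposition" "HOL-Library.Complex_Order"
begin

text \<open>
  Conventions: \<open>v \<bullet>c w = (\<Sum>i. v $ i * cnj (w $ i))\<close> is the inner product of \<open>\<complex>\<^sup>n\<close>, i.e. \<open>\<langle>w|v\<rangle>\<close>.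
  The basis vector \<open>|i\<rangle> \<otimes> |w\<rangle>\<close> of \<open>\<complex>\<^sup>m \<otimes> \<complex>\<^sup>n\<close> has index \<open>i * n + w\<close>.
\<close>

definition l2norm :: "complex vec \<Rightarrow> real" where
  "l2norm v = sqrt (\<Sum>i<dim_vec v. (cmod (v $ i))\<^sup>2)"

definition unitary_mat :: "nat \<Rightarrow> complex mat \<Rightarrow> bool" where
  "unitary_mat n A \<longleftrightarrow> A \<in> carrier_mat n n \<and> A * mat_adjoint A = 1\<^sub>m n \<and> mat_adjoint A * A = 1\<^sub>m n"

definition kron_mat :: "complex mat \<Rightarrow> complex mat \<Rightarrow> complex mat" where
  "kron_mat A B = mat (dim_row A * dim_row B) (dim_col A * dim_col B)
     (\<lambda>(r, c). A $$ (r div dim_row B, c div dim_col B) * B $$ (r mod dim_row B, c mod dim_col B))"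

definition kron_vec :: "complex vec \<Rightarrow> complex vec \<Rightarrow> complex vec" where
  "kron_vec v w = vec (dim_vec v * dim_vec w) (\<lambda>i. v $ (i div dim_vec w) * w $ (i mod dim_vec w))"

fun kron_vec_power :: "complex vec \<Rightarrow> nat \<Rightarrow> complex vec" where
  "kron_vec_power v 0 = unit_vec 1 0"
| "kron_vec_power v (Suc t) = kron_vec v (kron_vec_power v t)"


subsection \<open>Spectral data of the input unitary\<close>

definition orthonormal_basis :: "nat \<Rightarrow> (nat \<Rightarrow> complex vec) \<Rightarrow> bool" where
  "orthonormal_basis N u \<longleftrightarrow>
     (\<forall>j<N. u j \<in> carrier_vec N) \<and> (\<forall>i<N. \<forall>j<N. u i \<bullet>c u j = (if i = j then 1 else 0))"

definition computational_basis :: "nat \<Rightarrow> (nat \<Rightarrow> complex vec) \<Rightarrow> bool" where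
  "computational_basis N u \<longleftrightarrow> (\<forall>j<N. u j = unit_vec N j)"

text \<open>\<open>\<Sum>\<^sub>j e\<^sup>i\<^sup>\<theta>\<^sup>j |u\<^sub>j\<rangle>\<langle>u\<^sub>j|\<close>, written entrywise\<close>

definition spectral_unitary :: "nat \<Rightarrow> (nat \<Rightarrow> real) \<Rightarrow> (nat \<Rightarrow> complex vec) \<Rightarrow> complex mat" where
  "spectral_unitary N \<theta> u =
     mat N N (\<lambda>(r, c). \<Sum>j<N. cis (\<theta> j) * (u j $ r) * cnj (u j $ c))"

definition theta_max :: "nat \<Rightarrow> (nat \<Rightarrow> real) \<Rightarrow> real" where
  "theta_max N \<theta> = Max (\<theta> ` {..<N})"

definition eigenphase_space :: "nat \<Rightarrow> complex mat \<Rightarrow> real \<Rightarrow> complex vec set" where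
  "eigenphase_space N U \<phi> =
     LinearCombinations.module.span class_ring (module_vec TYPE(complex) N)
       {v. eigenvector U v (cis \<phi>)}"

text \<open>For a linear subspace \<open>S\<close> of \<open>\<complex>\<^sup>n\<close> and \<open>v \<in> \<complex>\<^sup>n\<close>, the vector described here exists uniquely.\<close>

definition orth_proj :: "complex vec set \<Rightarrow> complex vec \<Rightarrow> complex vec" where
  "orth_proj S v = (THE p. p \<in> S \<and> (\<forall>s\<in>S. (v - p) \<bullet>c s = 0))"


subsection \<open>Query algorithms\<close>

text \<open>
  The workspace is \<open>W = (\<complex>\<^sup>N)\<^sup>\<otimes>\<^sup>t \<otimes> \<complex>\<^sup>K\<close>: the \<open>t\<close> registers that initially hold the advice, and an
  ancilla of arbitrary dimension \<open>K \<ge> 1\<close>.  In \<open>Query adj ctrl\<close>, the flag \<open>adj\<close> selects the inverse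
  of the input unitary, and \<open>ctrl = Some k\<close> means that the query is controlled by the qubit of
  \<open>W\<close> given by bit \<open>k\<close> of the basis label.
\<close>

datatype qstep = Gate "complex mat" | Query bool "nat option"

datatype qalgorithm = QAlgorithm
  (anc_dim: nat) (qsteps: "qstep list") (povm: "(real \<times> complex mat) list")

definition work_dim :: "nat \<Rightarrow> nat \<Rightarrow> qalgorithm \<Rightarrow> nat" where
  "work_dim N t A = N ^ t * anc_dim A"

text \<open>
  Bit \<open>k\<close> is a tensor factor \<open>\<complex>\<^sup>2\<close> of \<open>\<complex>\<^sup>D\<close> (in the computational basis) iff \<open>2\<^sup>k\<^sup>+\<^sup>1\<close> divides \<open>D\<close>.
\<close>

fun wf_qstep :: "nat \<Rightarrow> nat \<Rightarrow> qstep \<Rightarrow> bool" where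
  "wf_qstep N D (Gate V) \<longleftrightarrow> unitary_mat (N * D) V"
| "wf_qstep N D (Query adj None) \<longleftrightarrow> True"
| "wf_qstep N D (Query adj (Some k)) \<longleftrightarrow> 2 ^ (k + 1) dvd D"

definition bit_proj :: "nat \<Rightarrow> nat \<Rightarrow> bool \<Rightarrow> complex mat" where
  "bit_proj D k b = mat D D (\<lambda>(r, c). if r = c \<and> bit r k = b then 1 else 0)"

fun query_mat :: "nat \<Rightarrow> nat \<Rightarrow> complex mat \<Rightarrow> nat option \<Rightarrow> complex mat" where
  "query_mat N D U None = kron_mat U (1\<^sub>m D)"
| "query_mat N D U (Some k) =
     kron_mat U (bit_proj D k True) + kron_mat (1\<^sub>m N) (bit_proj D k False)"

fun qstep_mat :: "nat \<Rightarrow> nat \<Rightarrow> complex mat \<Rightarrow> qstep \<Rightarrow> complex mat" where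
  "qstep_mat N D U (Gate V) = V"
| "qstep_mat N D U (Query adj ctrl) = query_mat N D (if adj then mat_adjoint U else U) ctrl"

definition is_povm :: "nat \<Rightarrow> (real \<times> complex mat) list \<Rightarrow> bool" where
  "is_povm n P \<longleftrightarrow>
     (\<forall>(x, E)\<in>set P. E \<in> carrier_mat n n \<and> (\<forall>v\<in>carrier_vec n. (E *\<^sub>v v) \<bullet>c v \<ge> 0)) \<and>
     foldr (\<lambda>(x, E) M. E + M) P (0\<^sub>m n n) = 1\<^sub>m n"

definition wf_qalgorithm :: "nat \<Rightarrow> nat \<Rightarrow> qalgorithm \<Rightarrow> bool" where
  "wf_qalgorithm N t A \<longleftrightarrow>
     anc_dim A \<ge> 1 \<and>
     (\<forall>s\<in>set (qsteps A). wf_qstep N (work_dim N t A) s) \<and>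
     is_povm (N * work_dim N t A) (povm A)"

fun is_query :: "qstep \<Rightarrow> bool" where
  "is_query (Gate V) \<longleftrightarrow> False"
| "is_query (Query adj ctrl) \<longleftrightarrow> True"

definition cost :: "qalgorithm \<Rightarrow> nat" where
  "cost A = length (filter is_query (qsteps A))"

definition initial_state :: "nat \<Rightarrow> nat \<Rightarrow> complex vec \<Rightarrow> qalgorithm \<Rightarrow> complex vec" where
  "initial_state N t \<alpha> A =
     kron_vec (unit_vec N 0) (kron_vec (kron_vec_power \<alpha> t) (unit_vec (anc_dim A) 0))"

definition final_state :: "nat \<Rightarrow> nat \<Rightarrow> complex vec \<Rightarrow> complex mat \<Rightarrow> qalgorithm \<Rightarrow> complex vec" where
  "final_state N t \<alpha> U A =
     fold (\<lambda>s \<psi>. qstep_mat N (work_dim N t A) U s *\<^sub>v \<psi>) (qsteps A) (initial_state N t \<alpha> A)"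

definition output_prob ::
  "nat \<Rightarrow> nat \<Rightarrow> complex vec \<Rightarrow> complex mat \<Rightarrow> qalgorithm \<Rightarrow> real set \<Rightarrow> real" where
  "output_prob N t \<alpha> U A X =
     (let \<psi> = final_state N t \<alpha> U A
      in \<Sum>(x, E)\<leftarrow>povm A. if x \<in> X then Re ((E *\<^sub>v \<psi>) \<bullet>c \<psi>) else 0)"


subsection \<open>The task\<close>

definition approx_mod_2pi :: "real \<Rightarrow> real \<Rightarrow> real set" where
  "approx_mod_2pi \<phi> \<delta> = {x. \<exists>k::int. x + 2 * pi * of_int k \<in> {\<phi> - \<delta>..\<phi> + \<delta>}}"

definition valid_advice ::
  "nat \<Rightarrow> real \<Rightarrow> (nat \<Rightarrow> real) \<Rightarrow> (nat \<Rightarrow> complex vec) \<Rightarrow> complex vec \<Rightarrow> bool" where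
  "valid_advice N \<gamma> \<theta> u \<alpha> \<longleftrightarrow>
     \<alpha> \<in> carrier_vec N \<and> l2norm \<alpha> = 1 \<and>
     (l2norm (orth_proj (eigenphase_space N (spectral_unitary N \<theta> u) (theta_max N \<theta>)) \<alpha>))\<^sup>2 \<ge> \<gamma>\<^sup>2"

definition solves_maxQPE ::
  "((nat \<Rightarrow> complex vec) \<Rightarrow> bool) \<Rightarrow> nat \<Rightarrow> real \<Rightarrow> real \<Rightarrow> nat \<Rightarrow> qalgorithm \<Rightarrow> bool" where
  "solves_maxQPE B N \<delta> \<gamma> t A \<longleftrightarrow>
     wf_qalgorithm N t A \<and>
     (\<forall>\<theta> u \<alpha>.
        orthonormal_basis N u \<and> B u \<and> (\<forall>j<N. \<theta> j \<in> {0..<2 * pi}) \<and>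
        theta_max N \<theta> \<in> {0..<2 * pi - 2 * \<delta>} \<and> valid_advice N \<gamma> \<theta> u \<alpha> \<longrightarrow>
        output_prob N t \<alpha> (spectral_unitary N \<theta> u) A (approx_mod_2pi (theta_max N \<theta>) \<delta>) \<ge> 2 / 3)"

definition solves_maxQPE_known_eigenbasis :: "nat \<Rightarrow> real \<Rightarrow> real \<Rightarrow> nat \<Rightarrow> qalgorithm \<Rightarrow> bool" where
  "solves_maxQPE_known_eigenbasis N = solves_maxQPE (computational_basis N) N"

definition solves_maxQPE_unknown_eigenbasis :: "nat \<Rightarrow> real \<Rightarrow> real \<Rightarrow> nat \<Rightarrow> qalgorithm \<Rightarrow> bool" where
  "solves_maxQPE_unknown_eigenbasis N = solves_maxQPE (\<lambda>u. True) N"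

end

theory Submission
  imports Defs "HOL-Analysis.L2_Norm"
begin

text \<open>
  Let \<open>M = \<lfloor>1 / \<gamma>\<^sup>2\<rfloor> \<le> N\<close> and let the advice be the uniform superposition of \<open>|0\<rangle>, \<dots>, |M - 1\<rangle>\<close>. It is
  valid for the identity and for each \<open>U\<^sub>j\<close> (\<open>j < M\<close>) that multiplies \<open>|j\<rangle>\<close> by \<open>e\<^sup>3\<^sup>i\<^sup>\<delta>\<close> and fixes the
  other basis states. Hence the advice, in whatever number of copies, carries no information about
  which of these unitaries is the input, although the identity and \<open>U\<^sub>j\<close> require disjoint sets of
  answers. By a hybrid argument, a query changes the vector of distances between the runs on \<open>U\<^sub>j\<close>
  and the run on the identity by at most \<open>|e\<^sup>3\<^sup>i\<^sup>\<delta> - 1| \<le> 3\<delta>\<close> in the \<open>\<ell>\<^sup>2\<close> norm over \<open>j\<close>, whereas at the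
  end each of its \<open>M\<close> entries must exceed a constant. This forces \<open>\<Omega>(\<surd>M / \<delta>)\<close> queries.
\<close>

section \<open>Euclidean norms, Kronecker products and adjoints\<close>

lemma cscalar_prod_sum:
  fixes v w :: "complex vec"
  shows "v \<bullet>c w = (\<Sum>i<dim_vec w. v $ i * cnj (w $ i))"
  by (simp add: scalar_prod_def lessThan_atLeast0)

lemma l2norm_L2_set: "l2norm v = L2_set (\<lambda>i. cmod (v $ i)) {..<dim_vec v}"
  by (simp add: l2norm_def L2_set_def)

lemma l2norm_nonneg: "0 \<le> l2norm v"
  by (simp add: l2norm_def sum_nonneg)

lemma l2norm_sq: "(l2norm v)\<^sup>2 = (\<Sum>i<dim_vec v. (cmod (v $ i))\<^sup>2)"
  by (simp add: l2norm_def sum_nonneg)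

lemma l2norm_sq_cscalar_prod: "(l2norm v)\<^sup>2 = Re (v \<bullet>c v)"
  by (simp add: l2norm_sq cscalar_prod_sum complex_norm_square[symmetric] flip: of_real_power)

lemma l2norm_add:
  assumes "v \<in> carrier_vec n" "w \<in> carrier_vec n"
  shows "l2norm (v + w) \<le> l2norm v + l2norm w"
proof -
  have "l2norm (v + w) = L2_set (\<lambda>i. cmod (v $ i + w $ i)) {..<n}"
    using assms by (auto simp: l2norm_L2_set intro!: L2_set_cong)
  also have "\<dots> \<le> L2_set (\<lambda>i. cmod (v $ i) + cmod (w $ i)) {..<n}"
    by (intro L2_set_mono norm_triangle_ineq) auto
  also have "\<dots> \<le> L2_set (\<lambda>i. cmod (v $ i)) {..<n} + L2_set (\<lambda>i. cmod (w $ i)) {..<n}"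
    by (rule L2_set_triangle_ineq)
  finally show ?thesis
    using assms by (simp add: l2norm_L2_set)
qed

lemma vec_diff_split:
  fixes x :: "'a::ab_group_add vec"
  assumes "x \<in> carrier_vec n" "y \<in> carrier_vec n" "z \<in> carrier_vec n"
  shows "x - z = (x - y) + (y - z)"
  using assms by (intro eq_vecI) auto

text \<open>The basis index \<open>a * n + b\<close> of a tensor product is sorted into blocks of
  length \<open>n\<close>, one for each \<open>a\<close>.\<close>

lemma sum_div_mod:
  fixes f :: "nat \<Rightarrow> nat \<Rightarrow> 'a::comm_monoid_add"
  shows "(\<Sum>i<m * n. f (i div n) (i mod n)) = (\<Sum>a<m. \<Sum>b<n. f a b)"
proof -
  have "(\<Sum>i<m * n. f (i div n) (i mod n))
      = (\<Sum>a<m. \<Sum>i\<in>{a * n..<a * n + n}. f (i div n) (i mod n))"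
    by (rule sum.nat_group[symmetric])
  also have "\<dots> = (\<Sum>a<m. \<Sum>b<n. f a b)"
  proof (rule sum.cong[OF refl])
    fix a
    have "(\<Sum>i\<in>{a * n..<a * n + n}. f (i div n) (i mod n))
        = (\<Sum>b\<in>{0..<n}. f ((b + a * n) div n) ((b + a * n) mod n))"
      using sum.shift_bounds_nat_ivl[of "\<lambda>i. f (i div n) (i mod n)" 0 "a * n" n]
      by (simp add: add.commute)
    then show "(\<Sum>i\<in>{a * n..<a * n + n}. f (i div n) (i mod n)) = (\<Sum>b<n. f a b)"
      by (simp add: lessThan_atLeast0)
  qed
  finally show ?thesis .
qed

lemma l2norm_kron_vec: "l2norm (kron_vec v w) = l2norm v * l2norm w"
proof -
  let ?m = "dim_vec v" and ?n = "dim_vec w"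
  have "(\<Sum>i<?m * ?n. (cmod (kron_vec v w $ i))\<^sup>2)
      = (\<Sum>i<?m * ?n. (cmod (v $ (i div ?n)))\<^sup>2 * (cmod (w $ (i mod ?n)))\<^sup>2)"
    by (intro sum.cong) (auto simp: kron_vec_def norm_mult power_mult_distrib)
  also have "\<dots> = (\<Sum>a<?m. \<Sum>b<?n. (cmod (v $ a))\<^sup>2 * (cmod (w $ b))\<^sup>2)"
    by (rule sum_div_mod)
  also have "\<dots> = (\<Sum>a<?m. (cmod (v $ a))\<^sup>2) * (\<Sum>b<?n. (cmod (w $ b))\<^sup>2)"
    by (simp add: sum_product)
  finally show ?thesis
    by (simp add: l2norm_def kron_vec_def real_sqrt_mult)
qed

lemma l2norm_unit_vec: "i < n \<Longrightarrow> l2norm (unit_vec n i) = 1"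
proof -
  assume "i < n"
  have "(\<Sum>k<n. (cmod (unit_vec n i $ k))\<^sup>2) = (\<Sum>k<n. if k = i then 1 else 0)"
    by (intro sum.cong) (auto simp: unit_vec_def)
  with \<open>i < n\<close> show ?thesis by (simp add: l2norm_def)
qed

lemma l2norm_kron_vec_power: "l2norm (kron_vec_power v t) = l2norm v ^ t"
  by (induction t) (simp_all add: l2norm_kron_vec l2norm_unit_vec)

lemma dim_kron_vec_power: "dim_vec (kron_vec_power v t) = dim_vec v ^ t"
  by (induction t) (simp_all add: kron_vec_def)

lemma mat_adjoint_carrier: "A \<in> carrier_mat n m \<Longrightarrow> mat_adjoint A \<in> carrier_mat m n"
  by (auto simp: mat_adjoint_def)

lemma index_mat_adjoint:
  "i < dim_col A \<Longrightarrow> j < dim_row A \<Longrightarrow> mat_adjoint A $$ (i, j) = cnj (A $$ (j, i))"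
  by (simp add: mat_adjoint_def mat_of_rows_index)

lemma cscalar_prod_mat_adjoint:
  fixes A :: "complex mat"
  assumes "A \<in> carrier_mat n m" "v \<in> carrier_vec m" "w \<in> carrier_vec n"
  shows "(A *\<^sub>v v) \<bullet>c w = v \<bullet>c (mat_adjoint A *\<^sub>v w)"
proof -
  have "(A *\<^sub>v v) \<bullet>c w = (\<Sum>i<n. \<Sum>k<m. A $$ (i, k) * v $ k * cnj (w $ i))"
    using assms
    by (auto simp: cscalar_prod_sum scalar_prod_def sum_distrib_right lessThan_atLeast0
        intro!: sum.cong)
  also have "\<dots> = (\<Sum>k<m. \<Sum>i<n. A $$ (i, k) * v $ k * cnj (w $ i))"
    by (rule sum.swap)
  also have "\<dots> = v \<bullet>c (mat_adjoint A *\<^sub>v w)"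
    using assms mat_adjoint_carrier[OF assms(1)]
    by (auto simp: cscalar_prod_sum scalar_prod_def sum_distrib_left lessThan_atLeast0
        index_mat_adjoint mult_ac intro!: sum.cong)
  finally show ?thesis .
qed

lemma l2norm_unitary_mat:
  assumes "unitary_mat n V" "v \<in> carrier_vec n"
  shows "l2norm (V *\<^sub>v v) = l2norm v"
proof -
  have V: "V \<in> carrier_mat n n" "mat_adjoint V * V = 1\<^sub>m n"
    using assms(1) by (auto simp: unitary_mat_def)
  have "(V *\<^sub>v v) \<bullet>c (V *\<^sub>v v) = v \<bullet>c (mat_adjoint V *\<^sub>v (V *\<^sub>v v))"
    using V assms(2) by (intro cscalar_prod_mat_adjoint) auto
  also have "mat_adjoint V *\<^sub>v (V *\<^sub>v v) = v"
    using assoc_mult_mat_vec[OF mat_adjoint_carrier[OF V(1)] V(1) assms(2)] V assms(2) by simp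
  finally have "(l2norm (V *\<^sub>v v))\<^sup>2 = (l2norm v)\<^sup>2"
    by (simp add: l2norm_sq_cscalar_prod)
  then show ?thesis
    by (simp add: l2norm_nonneg)
qed


section \<open>Queries to diagonal unitaries\<close>

text \<open>An uncontrolled query counts as always active, so that one formula covers both kinds of
  query.\<close>

definition ctrl_active :: "nat option \<Rightarrow> nat \<Rightarrow> bool" where
  "ctrl_active ctrl w = (case ctrl of None \<Rightarrow> True | Some k \<Rightarrow> bit w k)"

lemma mat_diag_mult_vec:
  "v \<in> carrier_vec n \<Longrightarrow> mat_diag n d *\<^sub>v v = vec n (\<lambda>i. d i * v $ i)"
proof (rule eq_vecI)
  fix i assume v: "v \<in> carrier_vec n" and "i < dim_vec (vec n (\<lambda>i. d i * v $ i))"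
  then have i: "i < n" by simp
  have "(mat_diag n d *\<^sub>v v) $ i = (\<Sum>k = 0..<n. (if i = k then d k else 0) * v $ k)"
    using v i by (simp add: mat_diag_def scalar_prod_def)
  also have "\<dots> = (\<Sum>k = 0..<n. if i = k then d k * v $ k else 0)"
    by (intro sum.cong) auto
  finally show "(mat_diag n d *\<^sub>v v) $ i = vec n (\<lambda>i. d i * v $ i) $ i"
    using i by simp
qed (simp add: mat_diag_def)

lemma mat_adjoint_mat_diag: "mat_adjoint (mat_diag n d) = mat_diag n (\<lambda>i. cnj (d i))"
proof (rule eq_matI)
  fix i j assume "i < dim_row (mat_diag n (\<lambda>i. cnj (d i)))" "j < dim_col (mat_diag n (\<lambda>i. cnj (d i)))"
  then show "mat_adjoint (mat_diag n d) $$ (i, j) = mat_diag n (\<lambda>i. cnj (d i)) $$ (i, j)"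
    by (auto simp: mat_diag_def index_mat_adjoint)
qed (simp_all add: mat_diag_def mat_adjoint_def)

lemma kron_mat_mat_diag:
  "kron_mat (mat_diag m d) (mat_diag n e) = mat_diag (m * n) (\<lambda>i. d (i div n) * e (i mod n))"
proof (rule eq_matI)
  fix r c
  assume "r < dim_row (mat_diag (m * n) (\<lambda>i. d (i div n) * e (i mod n)))"
    "c < dim_col (mat_diag (m * n) (\<lambda>i. d (i div n) * e (i mod n)))"
  then have rc: "r < m * n" "c < m * n" by (simp_all add: mat_diag_def)
  then have "n > 0" by (cases n) auto
  with rc have "r div n < m" "c div n < m" "r mod n < n" "c mod n < n"
    by (simp_all add: less_mult_imp_div_less)
  moreover have "r = c \<longleftrightarrow> r div n = c div n \<and> r mod n = c mod n"
    by (metis div_mult_mod_eq)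
  ultimately show "kron_mat (mat_diag m d) (mat_diag n e) $$ (r, c)
      = mat_diag (m * n) (\<lambda>i. d (i div n) * e (i mod n)) $$ (r, c)"
    using rc by (auto simp: kron_mat_def mat_diag_def)
qed (simp_all add: kron_mat_def mat_diag_def)

text \<open>For a controlled query, the projectors onto the two values of the control bit are
  diagonal and complementary, so exactly one of the two Kronecker products contributes at each basis
  index. A query to a diagonal input merely multiplies coordinates.\<close>

lemma query_mat_mat_diag:
  "query_mat N D (mat_diag N d) ctrl
     = mat_diag (N * D) (\<lambda>i. if ctrl_active ctrl (i mod D) then d (i div D) else 1)"
proof (cases ctrl)
  case None
  have "query_mat N D (mat_diag N d) ctrl = kron_mat (mat_diag N d) (mat_diag D (\<lambda>_. 1))"
    using None by simp
  then show ?thesis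
    using None by (simp only: kron_mat_mat_diag) (simp add: ctrl_active_def)
next
  case (Some k)
  have bp: "bit_proj D k b = mat_diag D (\<lambda>r. if bit r k = b then 1 else 0)" for b
    by (auto simp: bit_proj_def mat_diag_def)
  have "query_mat N D (mat_diag N d) ctrl
      = kron_mat (mat_diag N d) (mat_diag D (\<lambda>r. if bit r k = True then 1 else 0))
        + kron_mat (mat_diag N (\<lambda>_. 1)) (mat_diag D (\<lambda>r. if bit r k = False then 1 else 0))"
    using Some by (simp add: bp)
  also have "\<dots> = mat_diag (N * D) (\<lambda>i. if ctrl_active ctrl (i mod D) then d (i div D) else 1)"
    unfolding kron_mat_mat_diag using Some
    by (intro eq_matI) (auto simp: mat_diag_def ctrl_active_def)
  finally show ?thesis .
qed

text \<open>The inverse of a diagonal unitary is its entrywise conjugate, hence the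
  \<open>cnj\<close>.\<close>

definition query_phase :: "nat \<Rightarrow> (nat \<Rightarrow> complex) \<Rightarrow> bool \<Rightarrow> nat option \<Rightarrow> nat \<Rightarrow> complex" where
  "query_phase D d adj ctrl i =
     (if ctrl_active ctrl (i mod D) then if adj then cnj (d (i div D)) else d (i div D) else 1)"

lemma qstep_mat_mat_diag:
  "qstep_mat N D (mat_diag N d) (Query adj ctrl) = mat_diag (N * D) (query_phase D d adj ctrl)"
  by (auto simp: query_mat_mat_diag mat_adjoint_mat_diag query_phase_def intro!: arg_cong[of _ _ "mat_diag _"])

lemma query_mult_vec:
  "v \<in> carrier_vec (N * D) \<Longrightarrow>
     qstep_mat N D (mat_diag N d) (Query adj ctrl) *\<^sub>v v
       = vec (N * D) (\<lambda>i. query_phase D d adj ctrl i * v $ i)"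
  unfolding qstep_mat_mat_diag by (rule mat_diag_mult_vec)

lemma qstep_mult_carrier:
  assumes "wf_qstep N D s" "v \<in> carrier_vec (N * D)"
  shows "qstep_mat N D (mat_diag N d) s *\<^sub>v v \<in> carrier_vec (N * D)"
proof (cases s)
  case (Gate V)
  with assms show ?thesis by (auto simp: unitary_mat_def)
next
  case (Query adj ctrl)
  show ?thesis unfolding Query query_mult_vec[OF assms(2)] by simp
qed

lemma l2norm_qstep:
  assumes "wf_qstep N D s" "v \<in> carrier_vec (N * D)" "\<And>i. cmod (d i) = 1"
  shows "l2norm (qstep_mat N D (mat_diag N d) s *\<^sub>v v) = l2norm v"
proof (cases s)
  case (Gate V)
  with assms show ?thesis by (auto intro!: l2norm_unitary_mat)
next
  case (Query adj ctrl)
  have "cmod (query_phase D d adj ctrl i) = 1" for i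
    by (simp add: query_phase_def assms(3))
  then show ?thesis
    unfolding Query query_mult_vec[OF assms(2)]
    using assms(2) by (auto simp: l2norm_L2_set norm_mult intro!: L2_set_cong)
qed

lemma qstep_mult_diff:
  assumes "wf_qstep N D s" "v \<in> carrier_vec (N * D)" "w \<in> carrier_vec (N * D)"
  shows "qstep_mat N D (mat_diag N d) s *\<^sub>v v - qstep_mat N D (mat_diag N d) s *\<^sub>v w
      = qstep_mat N D (mat_diag N d) s *\<^sub>v (v - w)"
proof -
  have "qstep_mat N D (mat_diag N d) s \<in> carrier_mat (N * D) (N * D)"
    using assms(1) by (cases s) (simp_all add: qstep_mat_mat_diag unitary_mat_def del: qstep_mat.simps(2))
  then show ?thesis
    using mult_minus_distrib_mat_vec[OF _ assms(2,3)] by simp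
qed


section \<open>The hybrid argument\<close>

definition marked_phases :: "complex \<Rightarrow> nat \<Rightarrow> nat \<Rightarrow> complex" where
  "marked_phases z j i = (if i = j then z else 1)"

text \<open>This is \<open>final_state\<close> for a diagonal input, with the starting vector left
  free for the induction over the steps.\<close>

definition run :: "nat \<Rightarrow> nat \<Rightarrow> (nat \<Rightarrow> complex) \<Rightarrow> qstep list \<Rightarrow> complex vec \<Rightarrow> complex vec" where
  "run N D d = fold (\<lambda>s \<psi>. qstep_mat N D (mat_diag N d) s *\<^sub>v \<psi>)"

lemma run_carrier:
  "\<forall>s\<in>set ss. wf_qstep N D s \<Longrightarrow> v \<in> carrier_vec (N * D) \<Longrightarrow> run N D d ss v \<in> carrier_vec (N * D)"
  by (induction ss arbitrary: v) (simp_all add: run_def qstep_mult_carrier)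

lemma l2norm_run:
  "\<forall>s\<in>set ss. wf_qstep N D s \<Longrightarrow> v \<in> carrier_vec (N * D) \<Longrightarrow> (\<And>i. cmod (d i) = 1) \<Longrightarrow>
     l2norm (run N D d ss v) = l2norm v"
  by (induction ss arbitrary: v) (simp_all add: run_def qstep_mult_carrier l2norm_qstep)

text \<open>
  A query to the marked unitary differs from the identity only on the block of the mark, and the
  blocks of distinct marks are orthogonal.
\<close>

lemma marked_query_diff:
  assumes "v \<in> carrier_vec (N * D)" "cmod z = 1"
  shows "L2_set (\<lambda>j. l2norm (qstep_mat N D (mat_diag N (marked_phases z j)) (Query adj ctrl) *\<^sub>v v
        - qstep_mat N D (mat_diag N (\<lambda>_. 1)) (Query adj ctrl) *\<^sub>v v)) {..<M}
      \<le> cmod (z - 1) * l2norm v"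
proof -
  define e where "e j = l2norm (qstep_mat N D (mat_diag N (marked_phases z j)) (Query adj ctrl) *\<^sub>v v
        - qstep_mat N D (mat_diag N (\<lambda>_. 1)) (Query adj ctrl) *\<^sub>v v)" for j
  \<comment> \<open>Inverse queries use \<open>cnj z\<close>, which is as far from \<open>1\<close>
    as \<open>z\<close>, so they obey the same bound.\<close>
  have conj: "cmod (cnj z - 1) = cmod (z - 1)"
    by (metis complex_cnj_diff complex_cnj_one complex_mod_cnj)
  \<comment> \<open>Only an inequality, because the control may be inactive at an index inside the
    block of \<open>j\<close>.\<close>
  have e: "(e j)\<^sup>2 \<le> (\<Sum>i<N * D. if i div D = j then (cmod (z - 1))\<^sup>2 * (cmod (v $ i))\<^sup>2 else 0)" for j
  proof -
    have "(e j)\<^sup>2 = (\<Sum>i<N * D. (cmod (query_phase D (marked_phases z j) adj ctrl i * v $ i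
        - query_phase D (\<lambda>_. 1) adj ctrl i * v $ i))\<^sup>2)"
      unfolding e_def query_mult_vec[OF assms(1)] l2norm_sq by simp
    also have "\<dots> \<le> (\<Sum>i<N * D. if i div D = j then (cmod (z - 1))\<^sup>2 * (cmod (v $ i))\<^sup>2 else 0)"
    proof (rule sum_mono)
      fix i
      have "cmod (z * v $ i - v $ i) = cmod (z - 1) * cmod (v $ i)"
        "cmod (cnj z * v $ i - v $ i) = cmod (z - 1) * cmod (v $ i)"
        using norm_mult[of "z - 1" "v $ i"] norm_mult[of "cnj z - 1" "v $ i"]
        by (simp_all add: left_diff_distrib conj)
      then show "(cmod (query_phase D (marked_phases z j) adj ctrl i * v $ i
          - query_phase D (\<lambda>_. 1) adj ctrl i * v $ i))\<^sup>2
        \<le> (if i div D = j then (cmod (z - 1))\<^sup>2 * (cmod (v $ i))\<^sup>2 else 0)"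
        by (simp add: query_phase_def marked_phases_def power_mult_distrib)
    qed
    finally show ?thesis .
  qed
  have "(\<Sum>j<M. (e j)\<^sup>2)
      \<le> (\<Sum>j<M. \<Sum>i<N * D. if i div D = j then (cmod (z - 1))\<^sup>2 * (cmod (v $ i))\<^sup>2 else 0)"
    by (intro sum_mono e)
  also have "\<dots> = (\<Sum>i<N * D. \<Sum>j<M. if i div D = j then (cmod (z - 1))\<^sup>2 * (cmod (v $ i))\<^sup>2 else 0)"
    by (rule sum.swap)
  \<comment> \<open>Each index \<open>i\<close> lies in the single block \<open>i div D\<close>, so
    at most one mark contributes to its term.\<close>
  also have "\<dots> \<le> (\<Sum>i<N * D. (cmod (z - 1))\<^sup>2 * (cmod (v $ i))\<^sup>2)"
    by (intro sum_mono) (simp add: sum.delta)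
  also have "\<dots> = (cmod (z - 1) * l2norm v)\<^sup>2"
    using assms(1) by (simp add: power_mult_distrib l2norm_sq sum_distrib_left)
  finally have "L2_set e {..<M} \<le> cmod (z - 1) * l2norm v"
    unfolding L2_set_def by (intro real_le_lsqrt) (simp_all add: l2norm_nonneg)
  then show ?thesis
    unfolding e_def .
qed

text \<open>Induction over the steps; \<open>w\<close> and \<open>v\<close> are arbitrary so that
  the hypothesis applies after the first step. The distances for all marks are kept together in one
  \<open>L2_set\<close>, where Minkowski's inequality adds the errors of successive steps without a
  factor depending on \<open>M\<close>.\<close>

lemma hybrid_bound:
  assumes "cmod z = 1" "\<forall>s\<in>set ss. wf_qstep N D s"
    "\<And>j. w j \<in> carrier_vec (N * D)" "v \<in> carrier_vec (N * D)"
  shows "L2_set (\<lambda>j. l2norm (run N D (marked_phases z j) ss (w j) - run N D (\<lambda>_. 1) ss v)) {..<M}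
      \<le> L2_set (\<lambda>j. l2norm (w j - v)) {..<M}
        + cmod (z - 1) * l2norm v * length (filter is_query ss)"
  using assms(2-)
proof (induction ss arbitrary: w v)
  case Nil
  then show ?case by (simp add: run_def)
next
  case (Cons s ss)
  define A where "A j = qstep_mat N D (mat_diag N (marked_phases z j)) s" for j
  define B where "B = qstep_mat N D (mat_diag N (\<lambda>_. 1)) s"
  have wf: "wf_qstep N D s" using Cons.prems by simp
  note [simp] = Cons.prems(2,3)
  have phase: "cmod (marked_phases z j i) = 1" for i j
    by (simp add: marked_phases_def assms(1))
  have car: "A j *\<^sub>v x \<in> carrier_vec (N * D)" "B *\<^sub>v x \<in> carrier_vec (N * D)"
    if "x \<in> carrier_vec (N * D)" for x j
    unfolding A_def B_def by (intro qstep_mult_carrier[OF wf that])+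
  \<comment> \<open>The vector \<open>A j *\<^sub>v v\<close> is inserted between the two. The
    isometry \<open>A j\<close> preserves the old distance, and the new error is measured on the
    reference state \<open>v\<close>, which is the same for all \<open>j\<close>, as
    \<open>marked_query_diff\<close> demands.\<close>
  have step: "l2norm (A j *\<^sub>v w j - B *\<^sub>v v) \<le> l2norm (w j - v) + l2norm (A j *\<^sub>v v - B *\<^sub>v v)" for j
  proof -
    have "A j *\<^sub>v w j - B *\<^sub>v v = (A j *\<^sub>v w j - A j *\<^sub>v v) + (A j *\<^sub>v v - B *\<^sub>v v)"
      by (rule vec_diff_split[where n = "N * D"]) (simp_all add: car)
    also have "l2norm \<dots> \<le> l2norm (A j *\<^sub>v w j - A j *\<^sub>v v) + l2norm (A j *\<^sub>v v - B *\<^sub>v v)"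
      by (rule l2norm_add[where n = "N * D"]) (simp_all add: car)
    also have "l2norm (A j *\<^sub>v w j - A j *\<^sub>v v) = l2norm (w j - v)"
      unfolding A_def by (subst qstep_mult_diff) (auto simp: wf phase intro!: l2norm_qstep)
    finally show ?thesis .
  qed
  \<comment> \<open>A gate does not depend on the input, so only queries create new error.\<close>
  have err: "L2_set (\<lambda>j. l2norm (A j *\<^sub>v v - B *\<^sub>v v)) {..<M}
      \<le> cmod (z - 1) * l2norm v * (if is_query s then 1 else 0)"
  proof (cases s)
    case (Gate V)
    then have "A j *\<^sub>v v - B *\<^sub>v v = 0\<^sub>v (N * D)" for j
      using car(2)[OF Cons.prems(3)] by (simp add: A_def B_def)
    then show ?thesis using Gate by (simp add: l2norm_def L2_set_def)
  next
    case (Query adj ctrl)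
    then show ?thesis
      unfolding A_def B_def using marked_query_diff[OF Cons.prems(3) assms(1)] by simp
  qed
  have "L2_set (\<lambda>j. l2norm (A j *\<^sub>v w j - B *\<^sub>v v)) {..<M}
      \<le> L2_set (\<lambda>j. l2norm (w j - v) + l2norm (A j *\<^sub>v v - B *\<^sub>v v)) {..<M}"
    by (intro L2_set_mono step l2norm_nonneg)
  also have "\<dots> \<le> L2_set (\<lambda>j. l2norm (w j - v)) {..<M}
      + L2_set (\<lambda>j. l2norm (A j *\<^sub>v v - B *\<^sub>v v)) {..<M}"
    by (rule L2_set_triangle_ineq)
  finally have "L2_set (\<lambda>j. l2norm (A j *\<^sub>v w j - B *\<^sub>v v)) {..<M} \<le> \<dots>" .
  moreover have "L2_set (\<lambda>j. l2norm (run N D (marked_phases z j) ss (A j *\<^sub>v w j)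
        - run N D (\<lambda>_. 1) ss (B *\<^sub>v v))) {..<M}
      \<le> L2_set (\<lambda>j. l2norm (A j *\<^sub>v w j - B *\<^sub>v v)) {..<M}
        + cmod (z - 1) * l2norm (B *\<^sub>v v) * length (filter is_query ss)"
    using Cons.prems(1) by (intro Cons.IH car) auto
  moreover have "l2norm (B *\<^sub>v v) = l2norm v"
    unfolding B_def by (intro l2norm_qstep wf) auto
  ultimately show ?case
    using err by (simp add: run_def A_def B_def distrib_left split: if_splits)
qed


section \<open>Distinguishing states by a measurement\<close>

text \<open>Defined for arbitrary lists, since the tail of a POVM is in general not a POVM and the
  inductions below run over the list.\<close>

definition povm_prob :: "(real \<times> complex mat) list \<Rightarrow> complex vec \<Rightarrow> real set \<Rightarrow> real" where
  "povm_prob P v X = (\<Sum>(x, E)\<leftarrow>P. if x \<in> X then Re ((E *\<^sub>v v) \<bullet>c v) else 0)"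

lemma povm_prob_Cons:
  "povm_prob ((x, E) # P) v X = (if x \<in> X then Re ((E *\<^sub>v v) \<bullet>c v) else 0) + povm_prob P v X"
  by (simp add: povm_prob_def)

text \<open>
  For positive semidefinite \<open>E\<close> the second term can be dropped. The factor \<open>3/2\<close> is what makes the
  gap between \<open>1/3\<close> and \<open>2/3\<close> visible: the parallelogram law, with factor \<open>2\<close>, would be too weak.
\<close>

lemma quadratic_form_identity:
  fixes E :: "complex mat"
  assumes E: "E \<in> carrier_mat n n" and a: "a \<in> carrier_vec n" and b: "b \<in> carrier_vec n"
  shows "Re ((E *\<^sub>v (a + b)) \<bullet>c (a + b)) + Re ((E *\<^sub>v (a + (-2) \<cdot>\<^sub>v b)) \<bullet>c (a + (-2) \<cdot>\<^sub>v b)) / 2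
      = 3 / 2 * Re ((E *\<^sub>v a) \<bullet>c a) + 3 * Re ((E *\<^sub>v b) \<bullet>c b)"
proof -
  \<comment> \<open>At \<open>c = 1\<close> and \<open>c = -2\<close> the cross terms get the
    factors \<open>1\<close> and \<open>-2\<close>, so they cancel when half of the second expansion
    is added to the first.\<close>
  have expand: "(E *\<^sub>v (a + c \<cdot>\<^sub>v b)) \<bullet>c (a + c \<cdot>\<^sub>v b)
      = (E *\<^sub>v a) \<bullet>c a + cnj c * ((E *\<^sub>v a) \<bullet>c b) + c * ((E *\<^sub>v b) \<bullet>c a) + c * cnj c * ((E *\<^sub>v b) \<bullet>c b)"
    for c
  proof -
    have "E *\<^sub>v (a + c \<cdot>\<^sub>v b) = E *\<^sub>v a + c \<cdot>\<^sub>v (E *\<^sub>v b)"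
      using assms by (simp add: mult_add_distrib_mat_vec[of _ n n] mult_mat_vec[of _ n n])
    then show ?thesis
      using assms by (simp add: cscalar_prod_sum algebra_simps sum.distrib sum_distrib_left)
  qed
  have "Re ((E *\<^sub>v (a + b)) \<bullet>c (a + b))
      = Re ((E *\<^sub>v a) \<bullet>c a) + Re ((E *\<^sub>v a) \<bullet>c b) + Re ((E *\<^sub>v b) \<bullet>c a) + Re ((E *\<^sub>v b) \<bullet>c b)"
    using arg_cong[OF expand[of 1], of Re] by simp
  moreover have "Re ((E *\<^sub>v (a + (-2) \<cdot>\<^sub>v b)) \<bullet>c (a + (-2) \<cdot>\<^sub>v b))
      = Re ((E *\<^sub>v a) \<bullet>c a) - 2 * Re ((E *\<^sub>v a) \<bullet>c b) - 2 * Re ((E *\<^sub>v b) \<bullet>c a)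
        + 4 * Re ((E *\<^sub>v b) \<bullet>c b)"
    unfolding expand[of "-2"] by simp
  ultimately show ?thesis by linarith
qed

text \<open>The dimension of the partial sum is carried along in the induction, because distributing
  over \<open>E + M\<close> requires it.\<close>

lemma povm_total:
  assumes "\<forall>(x, E)\<in>set P. E \<in> carrier_mat n n" "v \<in> carrier_vec n"
  shows "foldr (\<lambda>(x, E) M. E + M) P (0\<^sub>m n n) \<in> carrier_mat n n
    \<and> (foldr (\<lambda>(x, E) M. E + M) P (0\<^sub>m n n) *\<^sub>v v) \<bullet>c v = (\<Sum>(x, E)\<leftarrow>P. (E *\<^sub>v v) \<bullet>c v)"
  using assms
proof (induction P)
  case Nil
  then show ?case by (auto simp: cscalar_prod_sum scalar_prod_def)
next
  case (Cons p P)
  obtain x E where p: "p = (x, E)" by (cases p)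
  let ?M = "foldr (\<lambda>(x, E) M. E + M) P (0\<^sub>m n n)"
  have E: "E \<in> carrier_mat n n" and M: "?M \<in> carrier_mat n n"
    and IH: "(?M *\<^sub>v v) \<bullet>c v = (\<Sum>(x, E)\<leftarrow>P. (E *\<^sub>v v) \<bullet>c v)"
    using Cons p by auto
  have "((E + ?M) *\<^sub>v v) \<bullet>c v = (E *\<^sub>v v) \<bullet>c v + (?M *\<^sub>v v) \<bullet>c v"
    using E M Cons.prems(2)
    by (subst add_mult_distrib_mat_vec[OF E M Cons.prems(2)], subst add_scalar_prod_distrib[of _ n]) auto
  then show ?case using E M IH p by simp
qed

lemma povm_prob_UNIV:
  assumes "is_povm n P" "v \<in> carrier_vec n"
  shows "povm_prob P v UNIV = (l2norm v)\<^sup>2"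
proof -
  have "povm_prob P v UNIV = Re (\<Sum>(x, E)\<leftarrow>P. (E *\<^sub>v v) \<bullet>c v)"
    unfolding povm_prob_def by (induction P) auto
  also have "(\<Sum>(x, E)\<leftarrow>P. (E *\<^sub>v v) \<bullet>c v) = v \<bullet>c v"
  proof -
    have "\<forall>(x, E)\<in>set P. E \<in> carrier_mat n n"
      and sum: "foldr (\<lambda>(x, E) M. E + M) P (0\<^sub>m n n) = 1\<^sub>m n"
      using assms(1) unfolding is_povm_def by blast+
    from povm_total[OF this(1) assms(2)] show ?thesis
      using assms(2) unfolding sum by simp
  qed
  finally show ?thesis by (simp add: l2norm_sq_cscalar_prod)
qed

text \<open>Every outcome contributes a nonnegative amount to at most one of the two sets.\<close>

lemma povm_prob_disjoint:
  assumes "\<forall>(x, E)\<in>set P. \<forall>v\<in>carrier_vec n. (E *\<^sub>v v) \<bullet>c v \<ge> 0" "v \<in> carrier_vec n" "X \<inter> Y = {}"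
  shows "povm_prob P v X + povm_prob P v Y \<le> povm_prob P v UNIV"
  using assms(1)
proof (induction P)
  case Nil
  then show ?case by (simp add: povm_prob_def)
next
  case (Cons p P)
  then have "povm_prob P v X + povm_prob P v Y \<le> povm_prob P v UNIV" by simp
  moreover have "Re ((snd p *\<^sub>v v) \<bullet>c v) \<ge> 0"
    using Cons.prems assms(2) by (auto simp: less_eq_complex_def)
  ultimately show ?case
    using assms(3) by (cases p) (auto simp: povm_prob_Cons)
qed

text \<open>The quadratic form identity is summed over the outcomes. The contribution of
  \<open>b\<close> is taken over all outcomes, not just those in \<open>X\<close>, so that for a
  POVM it becomes \<open>3 * (l2norm b)\<^sup>2\<close>.\<close>

lemma povm_prob_perturb:
  assumes "\<forall>(x, E)\<in>set P. E \<in> carrier_mat n n \<and> (\<forall>v\<in>carrier_vec n. (E *\<^sub>v v) \<bullet>c v \<ge> 0)"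
    "a \<in> carrier_vec n" "b \<in> carrier_vec n"
  shows "povm_prob P (a + b) X \<le> 3 / 2 * povm_prob P a X + 3 * povm_prob P b UNIV"
  using assms(1)
proof (induction P)
  case Nil
  then show ?case by (simp add: povm_prob_def)
next
  case (Cons p P)
  obtain x E where p: "p = (x, E)" by (cases p)
  have E: "E \<in> carrier_mat n n" and pos: "\<And>v. v \<in> carrier_vec n \<Longrightarrow> Re ((E *\<^sub>v v) \<bullet>c v) \<ge> 0"
    using Cons.prems p by (auto simp: less_eq_complex_def)
  have IH: "povm_prob P (a + b) X \<le> 3 / 2 * povm_prob P a X + 3 * povm_prob P b UNIV"
    using Cons by simp
  have "Re ((E *\<^sub>v (a + (-2) \<cdot>\<^sub>v b)) \<bullet>c (a + (-2) \<cdot>\<^sub>v b)) \<ge> 0" "Re ((E *\<^sub>v b) \<bullet>c b) \<ge> 0"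
    using assms by (auto intro!: pos)
  then have "(if x \<in> X then Re ((E *\<^sub>v (a + b)) \<bullet>c (a + b)) else 0)
      \<le> 3 / 2 * (if x \<in> X then Re ((E *\<^sub>v a) \<bullet>c a) else 0) + 3 * Re ((E *\<^sub>v b) \<bullet>c b)"
    using quadratic_form_identity[OF E assms(2,3)] by simp
  from add_mono[OF this IH] show ?case
    unfolding p povm_prob_Cons by (simp only: distrib_left add_ac UNIV_I if_True)
qed

text \<open>On \<open>v\<close> the set \<open>Y\<close> has probability at most \<open>1/3\<close>,
  so perturbation gives \<open>2/3 \<le> 3/2 * 1/3 + 3 * (l2norm (w - v))\<^sup>2\<close>, which is
  where \<open>1/18\<close> comes from.\<close>

lemma povm_distinguish:
  assumes P: "is_povm n P" and v: "v \<in> carrier_vec n" "l2norm v = 1" and w: "w \<in> carrier_vec n"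
    and XY: "X \<inter> Y = {}" and "povm_prob P v X \<ge> 2 / 3" "povm_prob P w Y \<ge> 2 / 3"
  shows "(l2norm (w - v))\<^sup>2 \<ge> 1 / 18"
proof -
  have psd: "\<forall>(x, E)\<in>set P. E \<in> carrier_mat n n \<and> (\<forall>v\<in>carrier_vec n. (E *\<^sub>v v) \<bullet>c v \<ge> 0)"
    using P unfolding is_povm_def by blast
  then have "\<forall>(x, E)\<in>set P. \<forall>v\<in>carrier_vec n. (E *\<^sub>v v) \<bullet>c v \<ge> 0"
    by fast
  then have "povm_prob P v X + povm_prob P v Y \<le> 1"
    using povm_prob_disjoint[OF _ v(1) XY] povm_prob_UNIV[OF P v(1)] v(2) by fastforce
  moreover have "v + (w - v) = w"
    using v w by (intro eq_vecI) auto
  then have "povm_prob P w Y \<le> 3 / 2 * povm_prob P v Y + 3 * (l2norm (w - v))\<^sup>2"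
    using povm_prob_perturb[OF psd v(1), of "w - v" Y] povm_prob_UNIV[OF P, of "w - v"] v w by simp
  ultimately show ?thesis using assms(6,7) by linarith
qed


section \<open>The hard instances\<close>

lemma eigenvector_mat_diag_iff:
  fixes d :: "nat \<Rightarrow> 'a::idom"
  assumes "v \<in> carrier_vec n"
  shows "mat_diag n d *\<^sub>v v = c \<cdot>\<^sub>v v \<longleftrightarrow> (\<forall>i<n. d i \<noteq> c \<longrightarrow> v $ i = 0)"
proof -
  have "d i * v $ i = c * v $ i \<longleftrightarrow> (d i \<noteq> c \<longrightarrow> v $ i = 0)" for i
    using mult_cancel_right[of "d i" "v $ i" c] by blast
  then show ?thesis
    using assms by (auto simp: mat_diag_mult_vec vec_eq_iff)
qed

text \<open>The eigenvectors are the nonzero elements of a coordinate subspace, so taking the span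
  adds just the zero vector.\<close>

lemma eigenphase_space_mat_diag:
  "eigenphase_space N (mat_diag N d) \<phi>
     = {v \<in> carrier_vec N. \<forall>i<N. d i \<noteq> cis \<phi> \<longrightarrow> v $ i = 0}" (is "_ = ?W")
proof -
  let ?V = "module_vec TYPE(complex) N"
  let ?S = "{v. eigenvector (mat_diag N d) v (cis \<phi>)}"
  let ?span = "LinearCombinations.module.span class_ring ?V"
  note mod = vec_module[where 'a = complex and n = N]
  have dim: "dim_row (mat_diag N d) = N"
    by (simp add: mat_diag_def)
  have S: "?S = ?W - {0\<^sub>v N}"
    using eigenvector_mat_diag_iff[of _ N d "cis \<phi>"] by (auto simp: eigenvector_def dim)
  then have car: "?S \<subseteq> carrier ?V"
    by (auto simp: module_vec_simps)
  have "submodule class_ring ?W ?V"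
    by (rule submodule.intro[OF mod]) (auto simp: module_vec_simps)
  moreover have "?S \<subseteq> ?W"
    using S by blast
  ultimately have "?span ?S \<subseteq> ?W"
    by (intro LinearCombinations.module.span_is_subset[OF mod])
  moreover have "?S \<subseteq> ?span ?S"
    by (rule LinearCombinations.module.in_own_span[OF mod car])
  moreover have "0\<^sub>v N \<in> ?span ?S"
    using submodule.zero_closed[OF LinearCombinations.module.span_is_submodule[OF mod car]]
    by (simp add: module_vec_simps)
  ultimately show ?thesis
    unfolding eigenphase_space_def using S by blast
qed

text \<open>Uniqueness: two candidates differ by an element of \<open>S\<close> that is orthogonal
  to all of \<open>S\<close>, hence to itself.\<close>

lemma orth_proj_eqI:
  assumes "S \<subseteq> carrier_vec n" "v \<in> carrier_vec n" "p \<in> S" "\<And>s. s \<in> S \<Longrightarrow> (v - p) \<bullet>c s = 0"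
    "\<And>s s'. s \<in> S \<Longrightarrow> s' \<in> S \<Longrightarrow> s - s' \<in> S"
  shows "orth_proj S v = p"
  unfolding orth_proj_def
proof (rule the_equality)
  show "p \<in> S \<and> (\<forall>s\<in>S. (v - p) \<bullet>c s = 0)"
    using assms by blast
next
  fix q assume q: "q \<in> S \<and> (\<forall>s\<in>S. (v - q) \<bullet>c s = 0)"
  have car: "p \<in> carrier_vec n" "q \<in> carrier_vec n" using assms q by auto
  have pq: "p - q \<in> S" using assms q by blast
  have "p - q = (v - q) - (v - p)"
    using car assms(2) by (intro eq_vecI) auto
  then have "(p - q) \<bullet>c (p - q) = (v - q) \<bullet>c (p - q) - (v - p) \<bullet>c (p - q)"
    using car assms(2) by (metis minus_carrier_vec carrier_vec_conjugate minus_scalar_prod_distrib)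
  also have "\<dots> = 0"
    using q assms(4) pq by simp
  finally have "p - q = 0\<^sub>v n"
    using car by (subst (asm) conjugate_square_eq_0_vec[of _ n]) auto
  then show "q = p"
    using car by (metis eq_iff_diff_eq_0 index_minus_vec(1) carrier_vecD eq_vecI index_zero_vec(1))
qed

lemma orth_proj_eigenphase_space_mat_diag:
  assumes "v \<in> carrier_vec N"
  shows "orth_proj (eigenphase_space N (mat_diag N d) \<phi>) v
     = vec N (\<lambda>i. if d i = cis \<phi> then v $ i else 0)"
  unfolding eigenphase_space_mat_diag
  using assms by (intro orth_proj_eqI[of _ N]) (auto simp: cscalar_prod_sum intro!: sum.neutral)

lemma spectral_unitary_unit_vec: "spectral_unitary N \<theta> (unit_vec N) = mat_diag N (\<lambda>i. cis (\<theta> i))"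
proof (rule eq_matI)
  fix r c assume "r < dim_row (mat_diag N (\<lambda>i. cis (\<theta> i)))" "c < dim_col (mat_diag N (\<lambda>i. cis (\<theta> i)))"
  then have rc: "r < N" "c < N" by (simp_all add: mat_diag_def)
  have "(\<Sum>j<N. cis (\<theta> j) * unit_vec N j $ r * cnj (unit_vec N j $ c))
      = (\<Sum>j<N. if j = r then if r = c then cis (\<theta> r) else 0 else 0)"
    using rc by (intro sum.cong) (auto simp: unit_vec_def)
  then show "spectral_unitary N \<theta> (unit_vec N) $$ (r, c) = mat_diag N (\<lambda>i. cis (\<theta> i)) $$ (r, c)"
    using rc by (simp add: spectral_unitary_def mat_diag_def)
qed (simp_all add: spectral_unitary_def mat_diag_def)

lemma orthonormal_basis_unit_vec: "orthonormal_basis N (unit_vec N)"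
proof -
  have "unit_vec N i \<bullet>c unit_vec N j = (if i = j then 1 else 0 :: complex)" if "i < N" "j < N" for i j
  proof -
    have "unit_vec N i \<bullet>c unit_vec N j = (\<Sum>k<N. if k = i then if i = j then 1 else 0 else 0 :: complex)"
      unfolding cscalar_prod_sum using that by (intro sum.cong) (auto simp: unit_vec_def)
    then show ?thesis using that by simp
  qed
  then show ?thesis by (simp add: orthonormal_basis_def)
qed

lemma l2norm_ge_component: "i < dim_vec v \<Longrightarrow> cmod (v $ i) \<le> l2norm v"
  using member_le_L2_set[of "{..<dim_vec v}" i "\<lambda>i. cmod (v $ i)"] by (simp add: l2norm_L2_set)

lemma l2norm_eigenphase_proj_ge:
  assumes "v \<in> carrier_vec N" "j < N" "d j = cis \<phi>"
  shows "cmod (v $ j) \<le> l2norm (orth_proj (eigenphase_space N (mat_diag N d) \<phi>) v)"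
  using l2norm_ge_component[of j "vec N (\<lambda>i. if d i = cis \<phi> then v $ i else 0)"] assms
  by (simp add: orth_proj_eigenphase_space_mat_diag)

text \<open>A single basis state of maximal phase lies in the top eigenspace, so its amplitude alone
  bounds the overlap from below.\<close>

lemma valid_advice_unit_vec:
  assumes "\<alpha> \<in> carrier_vec N" "l2norm \<alpha> = 1" "j < N" "\<theta> j = theta_max N \<theta>" "\<gamma>\<^sup>2 \<le> (cmod (\<alpha> $ j))\<^sup>2"
  shows "valid_advice N \<gamma> \<theta> (unit_vec N) \<alpha>"
  using power_mono[OF l2norm_eigenphase_proj_ge[of \<alpha> N j "\<lambda>i. cis (\<theta> i)" "theta_max N \<theta>"], of 2] assms
  unfolding valid_advice_def spectral_unitary_unit_vec by simp

section \<open>Phases and answer intervals\<close>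

lemma cmod_cis_minus_one: "cmod (cis x - 1) \<le> \<bar>x\<bar>"
proof (rule power2_le_imp_le)
  \<comment> \<open>The chord has length \<open>2 * \<bar>sin (x / 2)\<bar>\<close>, which is at
    most the arc.\<close>
  have "(cmod (cis x - 1))\<^sup>2 = 2 - 2 * cos x"
    unfolding cmod_power2 using sin_cos_squared_add[of x] by (simp add: power2_eq_square algebra_simps)
  also have "\<dots> = (2 * \<bar>sin (x / 2)\<bar>)\<^sup>2"
    using cos_double_sin[of "x / 2"] by (simp add: power_mult_distrib)
  also have "\<dots> \<le> \<bar>x\<bar>\<^sup>2"
    using abs_sin_x_le_abs_x[of "x / 2"] by (intro power_mono) auto
  finally show "(cmod (cis x - 1))\<^sup>2 \<le> \<bar>x\<bar>\<^sup>2" .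
qed simp

text \<open>The chord of a quarter turn gives \<open>2 \<le> (pi / 2)\<^sup>2\<close>. The bound
  serves to obtain \<open>5 * \<delta> < 2 * pi\<close> from \<open>\<delta> < 1\<close>.\<close>

lemma pi_gt_five_halves: "pi > 5 / 2"
proof -
  have "(cmod (\<i> - 1))\<^sup>2 \<le> (pi / 2)\<^sup>2"
    using cmod_cis_minus_one[of "pi / 2"] by (intro power_mono) simp_all
  then have "8 \<le> pi\<^sup>2"
    by (simp add: cmod_power2 power_divide)
  then have "(5 / 2)\<^sup>2 < pi\<^sup>2"
    by (simp add: power2_eq_square)
  then show ?thesis
    by (rule power2_less_imp_less) simp
qed

text \<open>The representatives of a common point in the two intervals would differ by an amount in
  \<open>{\<delta>..5 * \<delta>}\<close>, strictly between \<open>0\<close> and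
  \<open>2 * pi\<close>, yet by a multiple of \<open>2 * pi\<close>.\<close>

lemma approx_mod_2pi_disjoint:
  assumes "0 < \<delta>" "\<delta> < 1"
  shows "approx_mod_2pi 0 \<delta> \<inter> approx_mod_2pi (3 * \<delta>) \<delta> = {}"
proof -
  have False if "x + 2 * pi * of_int k \<in> {0 - \<delta>..0 + \<delta>}"
    "x + 2 * pi * of_int l \<in> {3 * \<delta> - \<delta>..3 * \<delta> + \<delta>}" for x :: real and k l :: int
  proof -
    let ?m = "2 * pi * (of_int l - of_int k :: real)"
    have "?m = (x + 2 * pi * of_int l) - (x + 2 * pi * of_int k)"
      by (simp add: algebra_simps)
    then have "\<delta> \<le> ?m" "?m \<le> 5 * \<delta>"
      using that unfolding atLeastAtMost_iff by linarith+
    then have "?m > 0" "?m < 2 * pi * 1"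
      using assms pi_gt_five_halves by linarith+
    then have "0 < (of_int l - of_int k :: real)" "(of_int l - of_int k :: real) < 1"
      using pi_gt_zero by (simp_all add: zero_less_mult_iff)
    then have "0 < l - k" "l - k < 1"
      unfolding of_int_diff[symmetric] by simp_all
    then show False by simp
  qed
  then show ?thesis by (auto simp: approx_mod_2pi_def simp del: atLeastAtMost_iff)
qed

section \<open>Runs of the algorithm and the uniform advice\<close>

lemma final_state_run:
  "final_state N t \<alpha> (mat_diag N d) A = run N (work_dim N t A) d (qsteps A) (initial_state N t \<alpha> A)"
  by (simp add: final_state_def run_def)

lemma output_prob_povm_prob:
  "output_prob N t \<alpha> U A X = povm_prob (povm A) (final_state N t \<alpha> U A) X"
  by (simp add: output_prob_def povm_prob_def Let_def)

lemma initial_state_carrier: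
  "\<alpha> \<in> carrier_vec N \<Longrightarrow> initial_state N t \<alpha> A \<in> carrier_vec (N * work_dim N t A)"
  by (rule carrier_vecI) (simp add: initial_state_def kron_vec_def dim_kron_vec_power work_dim_def)

lemma l2norm_initial_state:
  "N \<ge> 1 \<Longrightarrow> anc_dim A \<ge> 1 \<Longrightarrow> l2norm \<alpha> = 1 \<Longrightarrow> l2norm (initial_state N t \<alpha> A) = 1"
  by (simp add: initial_state_def l2norm_kron_vec l2norm_unit_vec l2norm_kron_vec_power)

lemma uniform_vec_l2norm:
  assumes "1 \<le> M" "M \<le> N"
  shows "l2norm (vec N (\<lambda>i. if i < M then complex_of_real (1 / sqrt (real M)) else 0)) = 1"
proof -
  have "(\<Sum>i<N. (cmod (vec N (\<lambda>i. if i < M then complex_of_real (1 / sqrt (real M)) else 0) $ i))\<^sup>2)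
      = (\<Sum>i<N. if i < M then 1 / real M else 0)"
    using assms by (intro sum.cong) (auto simp: norm_divide power_divide)
  also have "\<dots> = (\<Sum>i<M. 1 / real M)"
    using assms by (intro sum.mono_neutral_cong_right) auto
  finally show ?thesis
    using assms by (simp add: l2norm_def)
qed

text \<open>With \<open>T\<close> queries, the hybrid bound gives
  \<open>sqrt (M / 18) \<le> 3 * \<delta> * T\<close>, and the left side is at least
  \<open>1 / (6 * \<gamma>)\<close>; together these yield the constant \<open>1/18\<close>.\<close>

lemma known_eigenbasis_cost:
  assumes N: "N \<ge> 1" and \<gamma>: "1 / sqrt (real N) \<le> \<gamma>" "\<gamma> \<le> 1" and \<delta>: "0 < \<delta>" "\<delta> < 1"
    and A: "solves_maxQPE_known_eigenbasis N \<delta> \<gamma> t A"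
  shows "real (cost A) \<ge> 1 / 18 / (\<gamma> * \<delta>)"
proof -
  have \<gamma>0: "\<gamma> > 0"
    using N by (intro less_le_trans[OF _ \<gamma>(1)]) simp
  \<comment> \<open>Small enough that the uniform amplitude \<open>1 / sqrt M\<close> reaches
    \<gamma> and that \<open>M \<le> N\<close>, yet more than half of
    \<open>1 / \<gamma>\<^sup>2\<close>, because \<open>M \<ge> 1\<close>.\<close>
  define M where "M = nat \<lfloor>1 / \<gamma>\<^sup>2\<rfloor>"
  have ge1: "1 / \<gamma>\<^sup>2 \<ge> 1"
    using \<gamma>0 \<gamma>(2) by (simp add: power_le_one)
  have M1: "M \<ge> 1"
    using ge1 unfolding M_def by linarith
  have Mle: "real M \<le> 1 / \<gamma>\<^sup>2" and Mgt: "1 / \<gamma>\<^sup>2 < real M + 1"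
    using ge1 unfolding M_def by linarith+
  have "1 / real N \<le> \<gamma>\<^sup>2"
    using power_mono[OF \<gamma>(1), of 2] N by (simp add: power_divide)
  then have "1 / \<gamma>\<^sup>2 \<le> real N"
    using \<gamma>0 N by (simp add: field_simps)
  then have MN: "M \<le> N" using Mle by linarith
  have \<gamma>M: "\<gamma>\<^sup>2 \<le> 1 / real M"
    using Mle \<gamma>0 M1 by (simp add: field_simps)

  define \<alpha> where "\<alpha> = vec N (\<lambda>i. if i < M then complex_of_real (1 / sqrt (real M)) else 0)"
  have \<alpha>: "\<alpha> \<in> carrier_vec N" "l2norm \<alpha> = 1"
    using uniform_vec_l2norm[OF M1 MN] by (simp_all add: \<alpha>_def)
  have amp: "\<gamma>\<^sup>2 \<le> (cmod (\<alpha> $ j))\<^sup>2" if "j < M" for j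
    using that MN \<gamma>M by (simp add: \<alpha>_def norm_divide power_divide)

  define D where "D = work_dim N t A"
  \<comment> \<open>Correctness is specialised to the computational basis and to this one advice
    state, leaving only the phases free.\<close>
  have wfA: "anc_dim A \<ge> 1" "\<forall>s\<in>set (qsteps A). wf_qstep N D s" "is_povm (N * D) (povm A)"
    and succ: "\<And>\<theta>. \<lbrakk>\<forall>j<N. \<theta> j \<in> {0..<2 * pi}; theta_max N \<theta> \<in> {0..<2 * pi - 2 * \<delta>};
        valid_advice N \<gamma> \<theta> (unit_vec N) \<alpha>\<rbrakk> \<Longrightarrow>
      output_prob N t \<alpha> (mat_diag N (\<lambda>i. cis (\<theta> i))) A (approx_mod_2pi (theta_max N \<theta>) \<delta>) \<ge> 2 / 3"
    using A orthonormal_basis_unit_vec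
    unfolding solves_maxQPE_known_eigenbasis_def solves_maxQPE_def wf_qalgorithm_def D_def
      computational_basis_def
    by (auto simp flip: spectral_unitary_unit_vec)
  define \<psi> where "\<psi> = initial_state N t \<alpha> A"
  have \<psi>: "\<psi> \<in> carrier_vec (N * D)" "l2norm \<psi> = 1"
    unfolding \<psi>_def D_def using initial_state_carrier[OF \<alpha>(1)] l2norm_initial_state[OF N wfA(1) \<alpha>(2)]
    by auto
  define z where "z = cis (3 * \<delta>)"
  define \<chi> where "\<chi> = run N D (\<lambda>_. 1) (qsteps A) \<psi>"
  define \<chi>' where "\<chi>' j = run N D (marked_phases z j) (qsteps A) \<psi>" for j
  have z: "cmod z = 1" by (simp add: z_def)
  have \<chi>: "\<chi> \<in> carrier_vec (N * D)" "l2norm \<chi> = 1" "\<And>j. \<chi>' j \<in> carrier_vec (N * D)"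
    unfolding \<chi>_def \<chi>'_def using run_carrier[OF wfA(2) \<psi>(1)] l2norm_run[OF wfA(2) \<psi>(1)] \<psi>(2) by auto

  \<comment> \<open>The marked phase \<open>3 * \<delta>\<close> meets the input promise.\<close>
  have small: "3 * \<delta> < 2 * pi - 2 * \<delta>"
    using \<delta> pi_gt_five_halves by simp
  have "povm_prob (povm A) \<chi> (approx_mod_2pi 0 \<delta>) \<ge> 2 / 3"
  proof -
    have max: "theta_max N (\<lambda>_. 0) = 0"
      using N by (auto simp: theta_max_def image_constant_conv lessThan_empty_iff)
    \<comment> \<open>For the identity every basis state has the maximal phase, so index
      \<open>0\<close>, which lies in the support of \<alpha>, can be the witness.\<close>
    then have "valid_advice N \<gamma> (\<lambda>_. 0) (unit_vec N) \<alpha>"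
      using amp[of 0] M1 MN by (intro valid_advice_unit_vec[of _ _ 0] \<alpha>) auto
    then show ?thesis
      using succ[of "\<lambda>_. 0"] small \<delta> max
      by (simp add: output_prob_povm_prob final_state_run \<chi>_def \<psi>_def D_def del: mat_diag_one)
  qed
  moreover have "povm_prob (povm A) (\<chi>' j) (approx_mod_2pi (3 * \<delta>) \<delta>) \<ge> 2 / 3" if "j < M" for j
  proof -
    let ?\<theta> = "\<lambda>i. if i = j then 3 * \<delta> else 0"
    have jN: "j < N" using that MN by simp
    have max: "theta_max N ?\<theta> = 3 * \<delta>"
      unfolding theta_max_def using jN \<delta> by (intro Max_eqI) auto
    then have "valid_advice N \<gamma> ?\<theta> (unit_vec N) \<alpha>"
      using amp[OF that] jN by (intro valid_advice_unit_vec[of _ _ j] \<alpha>) auto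
    moreover have "(\<lambda>i. cis (?\<theta> i)) = marked_phases z j"
      by (auto simp: marked_phases_def z_def)
    ultimately show ?thesis
      using succ[of ?\<theta>] small \<delta> max
      by (simp add: output_prob_povm_prob final_state_run \<chi>'_def \<psi>_def D_def)
  qed
  ultimately have dist: "(l2norm (\<chi>' j - \<chi>))\<^sup>2 \<ge> 1 / 18" if "j < M" for j
    using povm_distinguish[OF wfA(3) \<chi>(1,2) \<chi>(3) approx_mod_2pi_disjoint[OF \<delta>]] that by blast

  let ?T = "real (cost A)"
  have "sqrt (real M / 18) = sqrt (\<Sum>j<M. 1 / 18)" by simp
  also have "\<dots> \<le> L2_set (\<lambda>j. l2norm (\<chi>' j - \<chi>)) {..<M}"
    unfolding L2_set_def by (intro real_sqrt_le_mono sum_mono dist) auto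
  \<comment> \<open>All runs start from the same state, advice copies included, so the initial
    distances vanish.\<close>
  also have "\<dots> \<le> L2_set (\<lambda>j. l2norm (\<psi> - \<psi>)) {..<M} + cmod (z - 1) * l2norm \<psi> * ?T"
    unfolding \<chi>_def \<chi>'_def cost_def using z wfA(2) \<psi>(1) by (intro hybrid_bound)
  also have "\<dots> = cmod (z - 1) * ?T"
    using \<psi> by (simp add: l2norm_def L2_set_def)
  also have "\<dots> \<le> 3 * \<delta> * ?T"
    using cmod_cis_minus_one[of "3 * \<delta>"] \<delta> by (intro mult_right_mono) (auto simp: z_def)
  finally have "sqrt (real M / 18) \<le> 3 * \<delta> * ?T" .
  \<comment> \<open>From \<open>1 / \<gamma>\<^sup>2 < M + 1 \<le> 2 * M\<close>, division by
    \<open>36\<close> gives the square of the claim.\<close>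
  moreover have "1 / (6 * \<gamma>) \<le> sqrt (real M / 18)"
  proof (rule real_le_rsqrt)
    have "(1 / (6 * \<gamma>))\<^sup>2 = 1 / \<gamma>\<^sup>2 / 36"
      by (simp add: power2_eq_square)
    also have "\<dots> \<le> real M / 18" using Mgt M1 by simp
    finally show "(1 / (6 * \<gamma>))\<^sup>2 \<le> real M / 18" .
  qed
  ultimately have "1 / (6 * \<gamma>) \<le> 3 * \<delta> * ?T" by linarith
  then show ?thesis
    using \<gamma>0 \<delta> by (simp add: field_simps)
qed

theorem lemma3p4:
  shows "\<forall>a>0::real. \<exists>c>0::real. \<forall>(N::nat) (\<gamma>::real) (\<delta>::real) (t::nat).
    N \<ge> 2 \<and> \<gamma> \<in> {1 / sqrt (real N)..1} \<and> \<delta> \<in> {0<..<1} \<and> real t \<ge> a / \<gamma>\<^sup>2 \<longrightarrow>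
    (\<forall>A. solves_maxQPE_known_eigenbasis N \<delta> \<gamma> t A \<longrightarrow> real (cost A) \<ge> c / (\<gamma> * \<delta>)) \<and>
    (\<forall>A. solves_maxQPE_unknown_eigenbasis N \<delta> \<gamma> t A \<longrightarrow> real (cost A) \<ge> c / (\<gamma> * \<delta>))"
proof -
  have known: "real (cost A) \<ge> 1 / 18 / (\<gamma> * \<delta>)"
    if "N \<ge> 2" "\<gamma> \<in> {1 / sqrt (real N)..1}" "\<delta> \<in> {0<..<1}" "solves_maxQPE_known_eigenbasis N \<delta> \<gamma> t A"
    for N t :: nat and \<gamma> \<delta> :: real and A
    using that by (intro known_eigenbasis_cost) auto
  \<comment> \<open>An algorithm that copes with every eigenbasis copes in particular with the
    computational one.\<close>
  moreover have "solves_maxQPE_known_eigenbasis N \<delta> \<gamma> t A"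
    if "solves_maxQPE_unknown_eigenbasis N \<delta> \<gamma> t A" for N t :: nat and \<gamma> \<delta> :: real and A
    using that unfolding solves_maxQPE_known_eigenbasis_def solves_maxQPE_unknown_eigenbasis_def
      solves_maxQPE_def by blast
  ultimately show ?thesis
    by (intro allI impI exI[of _ "1 / 18"] conjI) (blast | simp)+
qed

end
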